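(* Let $n\ge 1$ be an integer and let $\omega_n$ be a primitive $n$-th root of unity. Let $f(q)\in\mathbb{N}[q]$ and suppose $f(\omega_n^j)\in\mathbb{N}$ for each $j=1,\dots,n$. Let $X$ be any (finite) set of size $f(1)$. Then there exists an action of the cyclic group $C_n$ on $X$ such that $(X,C_n,f(q))$ exhibits the cyclic sieving phenomenon if and only if for each $k\mid n$, $$\sum_{j\mid k}\mu(k/j)\,f(\omega_n^j)\ \ge\ 0 .$$
   Context: $\mathbb{N}$ denotes the non-negative integers and $\mu$ the classical Möbius function. Let $C_n$ be a cyclic group of order $n$ generated by $\sigma_n$, acting on a finite set $X$, and let $f(q)\in\mathbb{N}[q]$. For $g\in C_n$ put $X^g=\{x\in X: g\cdot x=x\}$. The triple $(X,C_n,f(q))$ exhibits the cyclic sieving phenomenon (CSP) if $f(\omega_n^k)=|X^{\sigma_n^k}|$ for all $k\in\mathbb{Z}$, where $\omega_n$ is a fixed primitive $n$-th root of unity. *)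

theory Defs
  imports
    Complex_Main
    "HOL-Library.Complex_Order"
    "HOL-Computational_Algebra.Computational_Algebra"
    "HOL-Algebra.Group_Action"
    "HOL-Algebra.Generated_Groups"
begin

text \<open>
  On complex numbers, \<open>0 \<le> z\<close> is the order of \<^theory>\<open>HOL-Library.Complex_Order\<close>:
  \<open>z\<close> is real and non-negative.
\<close>

definition moebius_mu :: "nat \<Rightarrow> int" where
  "moebius_mu n = (if squarefree n then (- 1) ^ card (prime_factors n) else 0)"

definition primitive_root_of_unity :: "nat \<Rightarrow> complex \<Rightarrow> bool" where
  "primitive_root_of_unity n \<omega> \<longleftrightarrow>
     n > 0 \<and> \<omega> ^ n = 1 \<and> (\<forall>m. 0 < m \<and> m < n \<longrightarrow> \<omega> ^ m \<noteq> 1)"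

definition cyclic_group_of_order :: "nat \<Rightarrow> ('g, 'm) monoid_scheme \<Rightarrow> 'g \<Rightarrow> bool" where
  "cyclic_group_of_order n C \<sigma> \<longleftrightarrow>
     group C \<and> Coset.order C = n \<and> \<sigma> \<in> carrier C \<and> generate C {\<sigma>} = carrier C"

definition poly_value :: "nat poly \<Rightarrow> complex \<Rightarrow> complex" where
  "poly_value f z = poly (map_poly of_nat f) z"

text \<open>
  The map \<open>\<phi>\<close> is the action of the group \<open>C\<close> on \<open>X\<close>, and
  \<open>invariants X \<phi> g\<close> is the set of points of \<open>X\<close> fixed by \<open>g\<close>.
  The root of unity \<open>\<omega>\<close> and the generator \<open>\<sigma>\<close> are explicit parameters,
  since the condition matches powers of the one with powers of the other.
\<close>
definition exhibits_csp ::
    "nat \<Rightarrow> complex \<Rightarrow> ('g, 'm) monoid_scheme \<Rightarrow> 'g \<Rightarrow> 'x set \<Rightarrow> ('g \<Rightarrow> 'x \<Rightarrow> 'x) \<Rightarrow> nat poly \<Rightarrow> bool"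
  where
  "exhibits_csp n \<omega> C \<sigma> X \<phi> f \<longleftrightarrow>
     primitive_root_of_unity n \<omega> \<and> cyclic_group_of_order n C \<sigma> \<and>
     finite X \<and> group_action C X \<phi> \<and>
     (\<forall>k::int. poly_value f (\<omega> powi k) = of_nat (card (invariants X \<phi> (\<sigma> [^]\<^bsub>C\<^esub> k))))"

end

theory Submission
  imports Defs "HOL-Number_Theory.Cong" "HOL-Algebra.Multiplicative_Group"
begin

(* Both names are to refer to polynomials, not to fields of algebraic records. *)
hide_const (open) up_ring.coeff module.smult

text \<open>
  Let \<open>g(j) = f(\<omega>\<^sup>j)\<close>. If \<open>f\<close> records the fixed points of a cyclic action, then \<open>g(j)\<close>, for
  \<open>j\<close> dividing \<open>n\<close>, is the sum over the divisors \<open>d\<close> of \<open>j\<close> of the number of points of period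
  exactly \<open>d\<close>. Moebius inversion recovers these numbers as the sums in the theorem, so the
  sums are non-negative (\<open>moebius_sum_fixed_points\<close>).

  Conversely, non-negative sums \<open>e(k)\<close> prescribe how many points should have period \<open>k\<close>. Such
  points come in orbits of size \<open>k\<close>, so what has to be shown is that \<open>k\<close> divides \<open>e(k)\<close>.
  Equivalently, \<open>g(j)\<close> is the sum of \<open>k * b(k)\<close> over the common divisors \<open>k\<close> of \<open>n\<close> and \<open>j\<close>, for
  some integers \<open>b(k)\<close> (\<open>value_decomposition\<close>). The action then has \<open>b(k)\<close> cycles of length
  \<open>k\<close>, rotated by the generator (\<open>cyclic_action_with_cycle_counts\<close>), and the displayed formula
  for \<open>g\<close> is its fixed point count at every power of the generator.

  The decomposition comes from the coefficients \<open>a(i)\<close> of \<open>f\<close> modulo \<open>q\<^sup>n - 1\<close>. Because the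
  values \<open>g(j)\<close> are integers, \<open>a(i)\<close> depends only on \<open>gcd i n\<close> (\<open>cyclic_coeff_gcd\<close>). Hence
  \<open>a(i)\<close> is the sum over the divisors \<open>d\<close> of \<open>gcd i n\<close> of some integers \<open>\<beta>(d)\<close>, and
  \<open>f\<close> is, modulo \<open>q\<^sup>n - 1\<close>, the combination with coefficients \<open>\<beta>(d)\<close> of the polynomials
  \<open>1 + q\<^sup>d + q\<^sup>2\<^sup>d + \<dots>\<close> with \<open>n/d\<close> terms. Such a polynomial takes the value \<open>n/d\<close>
  at \<open>\<omega>\<^sup>j\<close> if \<open>n/d\<close> divides \<open>j\<close>, and \<open>0\<close> otherwise, so \<open>b(n/d) = \<beta>(d)\<close>.

  That \<open>a\<close> depends only on the greatest common divisor is usually read off from the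
  irreducibility of the cyclotomic polynomials. Here it follows from congruences: for a prime \<open>p\<close> the polynomials
  \<open>f(q)\<^sup>p\<close> and \<open>f(q\<^sup>p)\<close> agree modulo \<open>p\<close>, which gives \<open>g(pj) \<equiv> g(j)\<close> modulo \<open>p\<close> when
  \<open>p > n\<close>. If \<open>p\<close> also exceeds all the values of \<open>g\<close>, then \<open>g(pj) = g(j)\<close>
  (\<open>value_at_large_prime_multiple\<close>). Every residue class coprime to the modulus contains a product
  of such large primes (\<open>congruent_number_with_large_prime_factors\<close>), so \<open>g\<close>, and with it its
  Fourier transform \<open>a\<close>, is invariant under all units modulo \<open>n\<close>.
\<close>

section \<open>Integer polynomials modulo a prime\<close>

definition int_poly_value :: "int poly \<Rightarrow> complex \<Rightarrow> complex" where
  "int_poly_value r z = poly (map_poly of_int r) z"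

lemma int_poly_value_0 [simp]: "int_poly_value 0 z = 0"
  by (simp add: int_poly_value_def)

lemma int_poly_value_pCons [simp]:
  "int_poly_value (pCons a r) z = of_int a + z * int_poly_value r z"
  by (simp add: int_poly_value_def map_poly_pCons)

lemma int_poly_value_add [simp]:
  "int_poly_value (r + s) z = int_poly_value r z + int_poly_value s z"
  by (induction r s rule: poly_induct2) (simp_all add: algebra_simps)

lemma int_poly_value_smult [simp]:
  "int_poly_value (smult a r) z = of_int a * int_poly_value r z"
  by (induction r) (simp_all add: algebra_simps)

lemma int_poly_value_mult [simp]:
  "int_poly_value (r * s) z = int_poly_value r z * int_poly_value s z"
  by (induction r) (simp_all add: algebra_simps)

lemma int_poly_value_power [simp]:
  "int_poly_value (r ^ k) z = int_poly_value r z ^ k"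
  by (induction k) (simp_all add: one_pCons)

lemma int_poly_value_altdef:
  "int_poly_value r z = (\<Sum>i\<le>degree r. of_int (coeff r i) * z ^ i)"
  unfolding int_poly_value_def by (simp add: poly_altdef degree_map_poly coeff_map_poly)

lemma poly_value_altdef:
  "poly_value f z = (\<Sum>i\<le>degree f. of_nat (coeff f i) * z ^ i)"
  unfolding poly_value_def by (simp add: poly_altdef degree_map_poly coeff_map_poly)

lemma int_poly_value_of_nat:
  "int_poly_value (map_poly int f) z = poly_value f z"
  unfolding int_poly_value_altdef poly_value_altdef
  by (simp add: degree_map_poly coeff_map_poly)

text \<open>
  The inner binomial coefficients of a prime row are multiples of the prime. In this form the
  congruence also applies to polynomials, where the error term \<open>c\<close> is again a polynomial.
\<close>

lemma power_sum_prime: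
  fixes a b :: "'a :: comm_ring_1"
  assumes "prime p"
  shows "\<exists>c. (a + b) ^ p = a ^ p + b ^ p + of_nat p * c"
proof -
  have "p > 0" using assms by (simp add: prime_gt_0_nat)
  have "(a + b) ^ p = (\<Sum>k\<le>p. of_nat (p choose k) * a ^ k * b ^ (p - k))"
    by (rule binomial_ring)
  also have "{..p} = insert 0 (insert p {0<..<p})" by auto
  also have "(\<Sum>k\<in>insert 0 (insert p {0<..<p}). of_nat (p choose k) * a ^ k * b ^ (p - k)) =
      a ^ p + b ^ p + (\<Sum>k\<in>{0<..<p}. of_nat (p choose k) * a ^ k * b ^ (p - k))"
    using \<open>p > 0\<close> by (simp add: algebra_simps)
  also have "(\<Sum>k\<in>{0<..<p}. of_nat (p choose k) * a ^ k * b ^ (p - k)) =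
      (\<Sum>k\<in>{0<..<p}. of_nat p * (of_nat ((p choose k) div p) * a ^ k * b ^ (p - k)))"
  proof (intro sum.cong refl)
    fix k assume "k \<in> {0<..<p}"
    hence "p dvd (p choose k)" using assms by (intro dvd_choose_prime) auto
    hence "of_nat (p choose k) = (of_nat p * of_nat ((p choose k) div p) :: 'a)"
      by (metis dvd_mult_div_cancel of_nat_mult)
    thus "of_nat (p choose k) * a ^ k * b ^ (p - k) =
        of_nat p * (of_nat ((p choose k) div p) * a ^ k * b ^ (p - k))"
      by (simp add: algebra_simps)
  qed
  finally show ?thesis by (auto simp: sum_distrib_left[symmetric])
qed

lemma prime_dvd_power_minus_self:
  fixes a :: int
  assumes "prime p"
  shows "int p dvd a ^ p - a"
proof -
  have nat: "int p dvd int k ^ p - int k" for k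
  proof (induction k)
    case 0
    thus ?case using prime_gt_0_nat[OF assms] by (simp add: zero_power)
  next
    case (Suc k)
    obtain c where "(1 + int k) ^ p = 1 ^ p + int k ^ p + of_nat p * c"
      using power_sum_prime[OF assms] by blast
    hence "int (Suc k) ^ p - int (Suc k) = (int k ^ p - int k) + int p * c" by simp
    thus ?case using Suc by (metis dvd_add dvd_triv_left)
  qed
  define k where "k = nat (a mod int p)"
  have "p > 0" using assms by (simp add: prime_gt_0_nat)
  hence k: "int k = a mod int p" by (simp add: k_def)
  hence "[a = int k] (mod int p)" by (simp add: cong_def)
  hence "[a ^ p - a = int k ^ p - int k] (mod int p)"
    by (intro cong_diff cong_pow)
  thus ?thesis using nat[of k] cong_dvd_iff by blast
qed

text \<open>
  The Frobenius congruence \<open>f(q)\<^sup>p \<equiv> f(q\<^sup>p)\<close> modulo \<open>p\<close>, with an integer polynomial as the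
  quotient: that quotient is what can be averaged over the roots of unity later on.
\<close>

lemma frobenius_integer_polynomial:
  fixes f :: "int poly"
  assumes "prime p"
  shows "\<exists>r. \<forall>z. int_poly_value f z ^ p = int_poly_value f (z ^ p) + of_nat p * int_poly_value r z"
proof (induction f)
  case 0
  have "p > 0" using assms by (simp add: prime_gt_0_nat)
  thus ?case by (intro exI[of _ 0]) simp
next
  case (pCons a f)
  then obtain r where r:
    "\<And>z. int_poly_value f z ^ p = int_poly_value f (z ^ p) + of_nat p * int_poly_value r z"
    by blast
  obtain c where c: "([:a:] + [:0, 1:] * f) ^ p = [:a:] ^ p + ([:0, 1:] * f) ^ p + of_nat p * c"
    using power_sum_prime[OF assms] by blast
  obtain d where d: "a ^ p = a + int p * d"
    using prime_dvd_power_minus_self[OF assms, of a] by (metis dvdE diff_eq_eq add.commute)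
  have "int_poly_value (pCons a f) z ^ p = int_poly_value (pCons a f) (z ^ p) +
      of_nat p * int_poly_value ([:d:] + [:0, 1:] ^ p * r + c) z" for z
  proof -
    have "int_poly_value (pCons a f) z ^ p = int_poly_value (([:a:] + [:0, 1:] * f) ^ p) z"
      by simp
    also have "\<dots> = of_int (a ^ p) + z ^ p * int_poly_value f z ^ p + of_nat p * int_poly_value c z"
      unfolding c by (simp add: power_mult_distrib of_nat_poly)
    finally show ?thesis by (simp add: r d algebra_simps)
  qed
  thus ?case by blast
qed

section \<open>Sums over roots of unity\<close>

lemma primitive_root_power_mod:
  assumes "primitive_root_of_unity n \<omega>"
  shows "\<omega> ^ (m mod n) = \<omega> ^ m"
proof -
  have root: "\<omega> ^ n = 1" using assms by (simp add: primitive_root_of_unity_def)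
  have "\<omega> ^ m = \<omega> ^ (n * (m div n) + m mod n)" by simp
  also have "\<dots> = \<omega> ^ (m mod n)" by (simp only: power_add power_mult root power_one mult_1)
  finally show ?thesis by simp
qed

lemma primitive_root_power_eq_1_iff:
  assumes "primitive_root_of_unity n \<omega>"
  shows "\<omega> ^ m = 1 \<longleftrightarrow> n dvd m"
proof -
  have "n > 0" and least: "\<And>k. 0 < k \<Longrightarrow> k < n \<Longrightarrow> \<omega> ^ k \<noteq> 1"
    using assms by (auto simp: primitive_root_of_unity_def)
  have "\<omega> ^ m = 1 \<longleftrightarrow> \<omega> ^ (m mod n) = 1" by (simp add: primitive_root_power_mod[OF assms])
  also have "\<dots> \<longleftrightarrow> m mod n = 0" using \<open>n > 0\<close> least[of "m mod n"] by auto
  finally show ?thesis by (simp add: dvd_eq_mod_eq_0)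
qed

lemma sum_powers_root_of_unity:
  assumes "primitive_root_of_unity n \<omega>"
  shows "(\<Sum>j<n. (\<omega> ^ j) ^ m) = (if n dvd m then of_nat n else 0)"
proof -
  have swap: "(\<omega> ^ j) ^ m = (\<omega> ^ m) ^ j" for j by (simp add: mult.commute flip: power_mult)
  show ?thesis
  proof (cases "n dvd m")
    case True
    hence "\<omega> ^ m = 1" using primitive_root_power_eq_1_iff[OF assms] by simp
    thus ?thesis using True by (simp add: swap)
  next
    case False
    hence ne: "\<omega> ^ m \<noteq> 1" using primitive_root_power_eq_1_iff[OF assms] by simp
    have "(\<omega> ^ m) ^ n = 1"
      using primitive_root_power_eq_1_iff[OF assms, of "m * n"] by (simp add: power_mult)
    thus ?thesis using False ne by (simp add: swap geometric_sum)
  qed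
qed

text \<open>
  Only exponents divisible by \<open>n\<close> survive the summation. This replaces the theory of algebraic
  integers in the congruences between the values.
\<close>

lemma sum_over_roots_of_unity:
  assumes "primitive_root_of_unity n \<omega>"
  shows "\<exists>c::int. (\<Sum>j<n. int_poly_value r (\<omega> ^ j)) = of_int c"
proof -
  have "(\<Sum>j<n. int_poly_value r (\<omega> ^ j)) =
      (\<Sum>i\<le>degree r. of_int (coeff r i) * (\<Sum>j<n. (\<omega> ^ j) ^ i))"
    unfolding int_poly_value_altdef sum_distrib_left by (rule sum.swap)
  also have "\<dots> = of_int (\<Sum>i\<le>degree r. coeff r i * (if n dvd i then int n else 0))"
    unfolding sum_powers_root_of_unity[OF assms] of_int_sum by (intro sum.cong) auto
  finally show ?thesis by blast
qed

section \<open>Integral values at roots of unity\<close>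

lemma value_mod:
  assumes "primitive_root_of_unity n \<omega>" and val: "\<And>j. poly_value f (\<omega> ^ j) = of_nat (g j)"
  shows "g (j mod n) = g j"
proof -
  have "of_nat (g (j mod n)) = (of_nat (g j) :: complex)"
    using primitive_root_power_mod[OF assms(1), of j] by (simp flip: val)
  thus ?thesis by simp
qed

text \<open>
  Put \<open>m(j) = g(j)\<^sup>p - g(pj)\<close>, which is \<open>p\<close> times the value of an integer polynomial \<open>r\<close> at
  \<open>\<omega>\<^sup>j\<close>. The individual values of \<open>r\<close> are rational numbers not yet known to be integers, but
  the sum over \<open>j < n\<close> of their powers is an integer. With exponent \<open>p - 1\<close>, Fermat's theorem
  turns the sum of the powers of \<open>m\<close> modulo \<open>p\<close> into the number of \<open>j < n\<close> for which
  \<open>m(j)\<close> is not a multiple of \<open>p\<close>. This number is a multiple of \<open>p\<close> and is at most \<open>n < p\<close>, so it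
  is zero. Hence \<open>g(pj) \<equiv> g(j)\<^sup>p \<equiv> g(j)\<close> modulo \<open>p\<close>, and both sides are smaller than \<open>p\<close>.
\<close>

lemma value_at_large_prime_multiple:
  fixes g :: "nat \<Rightarrow> nat"
  assumes prim: "primitive_root_of_unity n \<omega>"
    and val: "\<And>j. poly_value f (\<omega> ^ j) = of_nat (g j)"
    and p: "prime p" "p > n" and bound: "\<And>j. g j < p"
  shows "g (p * i) = g i"
proof -
  have p1: "p > 1" using p(1) by (rule prime_gt_1_nat)
  have n: "n > 0" using prim by (simp add: primitive_root_of_unity_def)
  note period = value_mod[OF prim val]
  define m where "m j = int (g j) ^ p - int (g (p * j))" for j
  obtain r where r: "\<And>z. int_poly_value (map_poly int f) z ^ p =
      int_poly_value (map_poly int f) (z ^ p) + of_nat p * int_poly_value r z"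
    using frobenius_integer_polynomial[OF p(1)] by blast
  have m: "of_int (m j) = of_nat p * int_poly_value r (\<omega> ^ j)" for j
  proof -
    have "(\<omega> ^ j) ^ p = \<omega> ^ (p * j)" by (simp add: mult.commute flip: power_mult)
    thus ?thesis using r[of "\<omega> ^ j"] by (simp add: m_def int_poly_value_of_nat val)
  qed
  obtain c where c: "(\<Sum>j<n. int_poly_value (r ^ (p - 1)) (\<omega> ^ j)) = of_int c"
    using sum_over_roots_of_unity[OF prim] by blast
  have "of_int (\<Sum>j<n. m j ^ (p - 1)) = (of_int (int p ^ (p - 1) * c) :: complex)"
    unfolding of_int_sum of_int_power m power_mult_distrib sum_distrib_left[symmetric]
    by (simp flip: c)
  hence "(\<Sum>j<n. m j ^ (p - 1)) = int p ^ (p - 1) * c" by (simp only: of_int_eq_iff)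
  hence "int p dvd (\<Sum>j<n. m j ^ (p - 1))" using p1 by simp
  moreover have "[(\<Sum>j<n. m j ^ (p - 1)) = (\<Sum>j<n. if int p dvd m j then 0 else 1)] (mod int p)"
  proof (rule cong_sum)
    fix j
    show "[m j ^ (p - 1) = (if int p dvd m j then 0 else 1)] (mod int p)"
    proof (cases "int p dvd m j")
      case True
      hence "int p dvd m j ^ (p - 1)"
        using p1 by (meson dvd_power dvd_trans zero_less_diff)
      thus ?thesis using True by (simp add: cong_0_iff)
    next
      case False
      have "int p dvd m j * (m j ^ (p - 1) - 1)"
        using prime_dvd_power_minus_self[OF p(1), of "m j"] p1
        by (simp add: right_diff_distrib flip: power_Suc)
      hence "int p dvd m j ^ (p - 1) - 1" using False p(1) by (simp add: prime_dvd_mult_iff)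
      thus ?thesis using False by (simp add: cong_iff_dvd_diff)
    qed
  qed
  moreover have "(\<Sum>j<n. if int p dvd m j then 0 else 1) = int (card {j\<in>{..<n}. \<not> int p dvd m j})"
    by (simp add: sum.If_cases Int_def)
  ultimately have "int p dvd int (card {j\<in>{..<n}. \<not> int p dvd m j})"
    by (metis cong_dvd_iff)
  moreover have "card {j\<in>{..<n}. \<not> int p dvd m j} \<le> card {..<n}"
    by (intro card_mono) auto
  ultimately have "p dvd card {j\<in>{..<n}. \<not> int p dvd m j}"
    "card {j\<in>{..<n}. \<not> int p dvd m j} < p"
    using p(2) by simp_all
  hence "card {j\<in>{..<n}. \<not> int p dvd m j} = 0"
    using dvd_imp_le[of p "card {j\<in>{..<n}. \<not> int p dvd m j}"] by linarith
  hence "int p dvd m j" if "j < n" for j using that by auto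
  hence "int p dvd m (i mod n)" using n by simp
  moreover have "g (p * (i mod n)) = g (p * i)" by (metis period mod_mult_right_eq)
  hence "m (i mod n) = int (g i) ^ p - int (g (p * i))" by (simp add: m_def period)
  ultimately have "int p dvd int (g i) ^ p - int (g (p * i))" by simp
  hence "int p dvd (int (g i) ^ p - int (g (p * i))) - (int (g i) ^ p - int (g i))"
    using prime_dvd_power_minus_self[OF p(1)] by (rule dvd_diff)
  hence "[int (g i) = int (g (p * i))] (mod int p)" by (simp add: cong_iff_dvd_diff)
  thus ?thesis using bound by (simp add: cong_def)
qed

text \<open>
  Add to \<open>a\<close> the modulus times the product of all primes up to \<open>B\<close> that do not divide \<open>a\<close>. Each
  prime up to \<open>B\<close> then divides exactly one of the two summands.
\<close>

lemma congruent_number_with_large_prime_factors: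
  fixes a m B :: nat
  assumes "coprime a m" "m > 0"
  shows "\<exists>u>0. [u = a] (mod m) \<and> (\<forall>p. prime p \<longrightarrow> p dvd u \<longrightarrow> p > B)"
proof -
  define P where "P = {q. prime q \<and> q \<le> B \<and> \<not> q dvd a}"
  have fin: "finite P" by (rule finite_subset[of _ "{..B}"]) (auto simp: P_def)
  define u where "u = a + m * \<Prod>P"
  have "\<Prod>P \<noteq> 0" using fin by (auto simp: P_def)
  hence "u > 0" using assms by (simp add: u_def)
  moreover have "[u = a] (mod m)" by (simp add: u_def cong_def)
  moreover have "p > B" if p: "prime p" "p dvd u" for p
  proof (rule ccontr)
    assume B: "\<not> p > B"
    show False
    proof (cases "p dvd a")
      case True
      hence "p dvd m * \<Prod>P" using p by (simp add: u_def dvd_add_right_iff)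
      moreover have "\<not> p dvd m" using True assms p by (meson coprime_common_divisor not_prime_unit)
      ultimately have "p dvd \<Prod>P" using p by (simp add: prime_dvd_mult_iff)
      then obtain q where "q \<in> P" "p dvd q"
        using p fin by (auto simp: prime_dvd_prod_iff)
      thus False using True p by (auto simp: P_def dest: primes_dvd_imp_eq)
    next
      case False
      hence "p \<in> P" using p B by (simp add: P_def)
      hence "p dvd m * \<Prod>P" using fin by (metis dvd_mult dvd_prodI)
      thus False using False p by (simp add: u_def dvd_add_left_iff)
    qed
  qed
  ultimately show ?thesis by blast
qed

lemma invariant_under_multiplication:
  fixes g :: "nat \<Rightarrow> nat"
  assumes step: "\<And>p i. prime p \<Longrightarrow> p > B \<Longrightarrow> g (p * i) = g i"
    and "u > 0" "\<forall>p. prime p \<longrightarrow> p dvd u \<longrightarrow> p > B"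
  shows "g (u * i) = g i"
  using assms(2,3)
proof (induction u rule: prime_divisors_induct)
  case (factor p x)
  have "g (p * x * i) = g (x * i)" using step[of p "x * i"] factor by (simp add: mult.assoc)
  thus ?case using factor by auto
qed auto

section \<open>Coefficients modulo \<open>q\<^sup>n - 1\<close>\<close>

text \<open>
  For \<open>i < n\<close>, the coefficient of \<open>q\<^sup>i\<close> in the remainder of \<open>f\<close> modulo \<open>q\<^sup>n - 1\<close>, extended
  periodically to all \<open>i\<close>.
\<close>

definition cyclic_coeff :: "nat \<Rightarrow> nat poly \<Rightarrow> nat \<Rightarrow> nat" where
  "cyclic_coeff n f i = (\<Sum>l | l \<le> degree f \<and> [l = i] (mod n). coeff f l)"

lemma cyclic_coeff_cong: "[i = j] (mod n) \<Longrightarrow> cyclic_coeff n f i = cyclic_coeff n f j"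
  unfolding cyclic_coeff_def cong_def by simp

text \<open>
  The coefficients modulo \<open>q\<^sup>n - 1\<close> are recovered from the values by the inverse discrete
  Fourier transform. The number \<open>i'\<close> stands for \<open>-i\<close>, which keeps all exponents natural.
\<close>

lemma cyclic_coeff_fourier_inversion:
  assumes prim: "primitive_root_of_unity n \<omega>" and "n dvd i + i'"
  shows "of_nat n * of_nat (cyclic_coeff n f i) = (\<Sum>j<n. poly_value f (\<omega> ^ j) * (\<omega> ^ j) ^ i')"
proof -
  have iff: "n dvd l + i' \<longleftrightarrow> [l = i] (mod n)" for l
  proof -
    have "[i + i' = 0] (mod n)" using assms(2) by (simp add: cong_0_iff)
    hence "[l + i' = 0] (mod n) \<longleftrightarrow> [l + i' = i + i'] (mod n)"
      by (meson cong_sym cong_trans)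
    thus ?thesis by (simp add: cong_0_iff cong_add_rcancel_nat)
  qed
  have "(\<Sum>j<n. poly_value f (\<omega> ^ j) * (\<omega> ^ j) ^ i') =
      (\<Sum>j<n. \<Sum>l\<le>degree f. of_nat (coeff f l) * (\<omega> ^ j) ^ (l + i'))"
    unfolding poly_value_altdef sum_distrib_right by (simp add: power_add mult.assoc)
  also have "\<dots> = (\<Sum>l\<le>degree f. of_nat (coeff f l) * (\<Sum>j<n. (\<omega> ^ j) ^ (l + i')))"
    unfolding sum_distrib_left by (rule sum.swap)
  also have "\<dots> = (\<Sum>l\<le>degree f. if [l = i] (mod n) then of_nat n * of_nat (coeff f l) else 0)"
    unfolding sum_powers_root_of_unity[OF prim] iff by (intro sum.cong) auto
  also have "\<dots> = of_nat n * of_nat (cyclic_coeff n f i)"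
    unfolding cyclic_coeff_def of_nat_sum sum_distrib_left
    by (simp add: sum.If_cases Int_def)
  finally show ?thesis by simp
qed

lemma bij_betw_mult_mod:
  fixes u n :: nat
  assumes "coprime u n" "n > 0"
  shows "bij_betw (\<lambda>j. u * j mod n) {..<n} {..<n}"
proof -
  have "inj_on (\<lambda>j. u * j mod n) {..<n}"
    by (rule inj_onI) (use assms in \<open>metis cong_def cong_mult_lcancel_nat lessThan_iff mod_less\<close>)
  moreover have "(\<lambda>j. u * j mod n) ` {..<n} \<subseteq> {..<n}" using assms by auto
  ultimately show ?thesis by (simp add: bij_betw_def endo_inj_surj)
qed

text \<open>
  An invariance of the values under a unit \<open>u\<close> passes to their Fourier transform: substitute
  \<open>u * j\<close> for the summation index \<open>j\<close>.
\<close>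

lemma cyclic_coeff_mult:
  assumes prim: "primitive_root_of_unity n \<omega>" and u: "coprime u n"
    and inv: "\<And>j. poly_value f (\<omega> ^ (u * j)) = poly_value f (\<omega> ^ j)"
  shows "cyclic_coeff n f (u * i) = cyclic_coeff n f i"
proof -
  have n: "n > 0" using prim by (simp add: primitive_root_of_unity_def)
  \<comment> \<open>This represents \<open>-i\<close> modulo \<open>n\<close>.\<close>
  define i' where "i' = (n - 1) * i"
  have i': "i + i' = n * i" using n by (simp add: i'_def algebra_simps flip: mult_Suc)
  define h where "h j = poly_value f (\<omega> ^ j) * (\<omega> ^ j) ^ i'" for j
  have "n dvd u * i + u * i'" using i' by (metis distrib_left dvd_mult dvd_triv_left)
  hence "of_nat n * of_nat (cyclic_coeff n f (u * i)) = (\<Sum>j<n. poly_value f (\<omega> ^ j) * (\<omega> ^ j) ^ (u * i'))"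
    by (rule cyclic_coeff_fourier_inversion[OF prim])
  also have "\<dots> = (\<Sum>j<n. h (u * j mod n))"
    unfolding h_def primitive_root_power_mod[OF prim] inv
    by (simp add: mult_ac flip: power_mult)
  also have "\<dots> = (\<Sum>j<n. h j)" by (rule sum.reindex_bij_betw[OF bij_betw_mult_mod[OF u n]])
  also have "\<dots> = of_nat n * of_nat (cyclic_coeff n f i)"
    unfolding h_def by (rule cyclic_coeff_fourier_inversion[OF prim, symmetric]) (simp add: i')
  finally show ?thesis using n by simp
qed

text \<open>
  With \<open>d = gcd i n\<close>, the class of \<open>i/d\<close> is a unit modulo \<open>n/d\<close>. Represented by a number \<open>u\<close>
  with large prime factors only, it becomes a unit modulo \<open>n\<close> under which the values are invariant, and
  \<open>i \<equiv> u * d\<close> modulo \<open>n\<close>.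
\<close>

lemma cyclic_coeff_gcd:
  fixes g :: "nat \<Rightarrow> nat"
  assumes prim: "primitive_root_of_unity n \<omega>"
    and val: "\<And>j. poly_value f (\<omega> ^ j) = of_nat (g j)"
  shows "cyclic_coeff n f i = cyclic_coeff n f (gcd i n)"
proof -
  have n: "n > 0" using prim by (simp add: primitive_root_of_unity_def)
  define d where "d = gcd i n"
  have d: "d > 0" using n by (simp add: d_def)
  obtain i' n' where i': "i = d * i'" and n': "n = d * n'"
    unfolding d_def by (metis dvdE gcd_dvd1 gcd_dvd2)
  have "coprime i' n'"
    using n d_def d i' n' by (metis gcd_mult_distrib_nat mult.right_neutral mult_cancel1 neq0_conv coprime_iff_gcd_eq_1)
  have "n' > 0" using n unfolding n' by simp
  \<comment> \<open>Primes above \<open>B\<close> exceed all values of \<open>g\<close> and do not divide \<open>n\<close>.\<close>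
  define B where "B = n + Max (g ` {..<n})"
  note period = value_mod[OF prim val]
  have bound: "g j \<le> B" for j
  proof -
    have "g (j mod n) \<le> Max (g ` {..<n})" using n by (intro Max_ge) auto
    thus ?thesis by (simp add: B_def period)
  qed
  obtain u where u: "u > 0" "[u = i'] (mod n')" "\<forall>p. prime p \<longrightarrow> p dvd u \<longrightarrow> p > B"
    using congruent_number_with_large_prime_factors[OF \<open>coprime i' n'\<close> \<open>n' > 0\<close>] by blast
  have "g (u * j) = g j" for j
  proof (rule invariant_under_multiplication[OF _ u(1,3)])
    fix p i assume "prime p" "p > B"
    thus "g (p * i) = g i"
      using bound by (intro value_at_large_prime_multiple[OF prim val]) (auto simp: B_def intro: le_less_trans)
  qed
  moreover have "coprime u n"
  proof (rule ccontr)
    assume "\<not> coprime u n"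
    hence "gcd u n \<noteq> 1" by (simp add: coprime_iff_gcd_eq_1)
    then obtain p where "prime p" "p dvd gcd u n" using prime_factor_nat by blast
    hence "p > B" "p \<le> n" using u(3) n by (auto dest: dvd_imp_le)
    thus False by (simp add: B_def)
  qed
  ultimately have "cyclic_coeff n f (u * d) = cyclic_coeff n f d"
    by (intro cyclic_coeff_mult[OF prim]) (simp_all add: val)
  moreover have "[u * d = i] (mod n)"
    using u(2) unfolding i' n' by (simp add: cong_def mult.commute flip: mult_mod_right)
  ultimately show ?thesis by (metis cyclic_coeff_cong d_def)
qed

section \<open>Decomposition of the values into cycle contributions\<close>

text \<open>
  The inverse of summation over divisors, obtained by solving for the term at \<open>d\<close> itself.
\<close>

fun divisor_difference :: "(nat \<Rightarrow> int) \<Rightarrow> nat \<Rightarrow> int" where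
  "divisor_difference \<alpha> d = \<alpha> d - (\<Sum>d' | d' dvd d \<and> d' < d. divisor_difference \<alpha> d')"

declare divisor_difference.simps [simp del]

lemma sum_divisor_difference:
  assumes "d > 0"
  shows "(\<Sum>d' | d' dvd d. divisor_difference \<alpha> d') = \<alpha> d"
proof -
  have "{d'. d' dvd d} = insert d {d'. d' dvd d \<and> d' < d}" using assms by (auto dest: dvd_imp_le)
  thus ?thesis by (simp add: divisor_difference.simps[of \<alpha> d])
qed

text \<open>
  As \<open>\<omega>\<^sup>d\<close> is a primitive \<open>k\<close>-th root of unity, this is the orthogonality relation of order
  \<open>k\<close>. The result is the number of fixed points of the \<open>j\<close>-th power of a cycle of length \<open>k\<close>.
\<close>

lemma sum_powers_over_multiples:
  assumes prim: "primitive_root_of_unity (d * k) \<omega>"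
  shows "(\<Sum>i | i < d * k \<and> d dvd i. (\<omega> ^ j) ^ i) = (if k dvd j then of_nat k else 0)"
proof -
  have dk: "d > 0" "k > 0" using prim by (simp_all add: primitive_root_of_unity_def)
  have "(\<omega> ^ d) ^ m = 1 \<longleftrightarrow> k dvd m" for m
    using primitive_root_power_eq_1_iff[OF prim, of "d * m"] dk by (simp add: power_mult)
  hence "primitive_root_of_unity k (\<omega> ^ d)"
    using dk by (auto simp: primitive_root_of_unity_def dest: dvd_imp_le)
  hence "(\<Sum>t<k. ((\<omega> ^ d) ^ t) ^ j) = (if k dvd j then of_nat k else 0)"
    by (rule sum_powers_root_of_unity)
  moreover have "(\<Sum>i | i < d * k \<and> d dvd i. (\<omega> ^ j) ^ i) = (\<Sum>t<k. ((\<omega> ^ d) ^ t) ^ j)"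
    using dk by (intro sum.reindex_bij_witness[of _ "\<lambda>t. d * t" "\<lambda>i. i div d"])
      (auto simp: less_mult_imp_div_less mult.commute mult.left_commute simp flip: power_mult)
  ultimately show ?thesis by simp
qed

lemma value_eq_cyclic_sum:
  assumes prim: "primitive_root_of_unity n \<omega>"
  shows "poly_value f (\<omega> ^ j) = (\<Sum>i<n. of_nat (cyclic_coeff n f i) * (\<omega> ^ j) ^ i)"
proof -
  have n: "n > 0" using prim by (simp add: primitive_root_of_unity_def)
  have "poly_value f (\<omega> ^ j) = (\<Sum>i<n. \<Sum>l | l \<in> {..degree f} \<and> l mod n = i. of_nat (coeff f l) * (\<omega> ^ j) ^ l)"
    unfolding poly_value_altdef using n by (intro sum.group[symmetric]) auto
  also have "\<dots> = (\<Sum>i<n. of_nat (cyclic_coeff n f i) * (\<omega> ^ j) ^ i)"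
  proof (rule sum.cong[OF refl])
    fix i assume i: "i \<in> {..<n}"
    have "(\<omega> ^ j) ^ l = (\<omega> ^ j) ^ i" if "l mod n = i" for l
      using that primitive_root_power_mod[OF prim, of l]
      by (metis mult.commute power_mult)
    hence "(\<Sum>l | l \<in> {..degree f} \<and> l mod n = i. of_nat (coeff f l) * (\<omega> ^ j) ^ l) =
        (\<Sum>l | l \<in> {..degree f} \<and> l mod n = i. of_nat (coeff f l) * (\<omega> ^ j) ^ i)"
      by (intro sum.cong) auto
    thus "(\<Sum>l | l \<in> {..degree f} \<and> l mod n = i. of_nat (coeff f l) * (\<omega> ^ j) ^ l) =
        of_nat (cyclic_coeff n f i) * (\<omega> ^ j) ^ i"
      using i by (simp add: cyclic_coeff_def cong_def sum_distrib_right)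
  qed
  finally show ?thesis .
qed

text \<open>
  The arithmetic heart of the construction: the values at roots of unity are the fixed point
  counts of a virtual permutation with \<open>b(k)\<close> cycles of length \<open>k\<close>, where \<open>b(k)\<close> may be negative.
\<close>

lemma value_decomposition:
  fixes g :: "nat \<Rightarrow> nat"
  assumes prim: "primitive_root_of_unity n \<omega>"
    and val: "\<And>j. poly_value f (\<omega> ^ j) = of_nat (g j)"
  shows "\<exists>b :: nat \<Rightarrow> int. \<forall>j. int (g j) = (\<Sum>k | k dvd n \<and> k dvd j. int k * b k)"
proof -
  have n: "n > 0" using prim by (simp add: primitive_root_of_unity_def)
  define \<beta> where "\<beta> = divisor_difference (\<lambda>i. int (cyclic_coeff n f i))"
  \<comment> \<open>The exponents divisible by \<open>d\<close> contribute a cycle of the complementary length \<open>n/d\<close>.\<close>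
  define b where "b k = \<beta> (n div k)" for k
  have coeff: "int (cyclic_coeff n f i) = (\<Sum>d | d dvd n. if d dvd i then \<beta> d else 0)" for i
  proof -
    have "int (cyclic_coeff n f i) = (\<Sum>d | d dvd gcd i n. \<beta> d)"
      unfolding cyclic_coeff_gcd[OF prim val, of i] \<beta>_def
      using n by (intro sum_divisor_difference[symmetric]) simp
    also have "\<dots> = (\<Sum>d | d dvd n. if d dvd i then \<beta> d else 0)"
      using n by (simp add: sum.If_cases Int_def conj_commute)
    finally show ?thesis .
  qed
  have "of_int (int (g j)) = (of_int (\<Sum>k | k dvd n \<and> k dvd j. int k * b k) :: complex)" for j
  proof -
    have "of_int (int (g j)) = (\<Sum>i<n. of_int (int (cyclic_coeff n f i)) * (\<omega> ^ j) ^ i)"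
      using value_eq_cyclic_sum[OF prim, of f j] by (simp add: val)
    also have "\<dots> = (\<Sum>i<n. \<Sum>d | d dvd n. of_int (if d dvd i then \<beta> d else 0) * (\<omega> ^ j) ^ i)"
      unfolding coeff of_int_sum sum_distrib_right ..
    also have "\<dots> = (\<Sum>d | d dvd n. \<Sum>i<n. of_int (if d dvd i then \<beta> d else 0) * (\<omega> ^ j) ^ i)"
      by (rule sum.swap)
    also have "\<dots> = (\<Sum>d | d dvd n. of_int (\<beta> d) * (if n div d dvd j then of_nat (n div d) else 0))"
    proof (rule sum.cong[OF refl])
      fix d assume "d \<in> {d. d dvd n}"
      hence nd: "n = d * (n div d)" by simp
      have "(\<Sum>i<n. of_int (if d dvd i then \<beta> d else 0) * (\<omega> ^ j) ^ i) =
          (\<Sum>i<n. if d dvd i then of_int (\<beta> d) * (\<omega> ^ j) ^ i else 0)"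
        by (intro sum.cong) auto
      also have "\<dots> = of_int (\<beta> d) * (\<Sum>i | i < n \<and> d dvd i. (\<omega> ^ j) ^ i)"
        by (simp add: sum.If_cases Int_def sum_distrib_left)
      also have "(\<Sum>i | i < n \<and> d dvd i. (\<omega> ^ j) ^ i) = (if n div d dvd j then of_nat (n div d) else 0)"
        using sum_powers_over_multiples[of d "n div d" \<omega> j] prim nd by simp
      finally show "(\<Sum>i<n. of_int (if d dvd i then \<beta> d else 0) * (\<omega> ^ j) ^ i) =
          of_int (\<beta> d) * (if n div d dvd j then of_nat (n div d) else 0)" .
    qed
    also have "\<dots> = (\<Sum>k | k dvd n. of_int (b k) * (if k dvd j then of_nat k else 0))"
      using n by (intro sum.reindex_bij_witness[of _ "\<lambda>k. n div k" "\<lambda>k. n div k"])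
        (auto simp: b_def)
    also have "\<dots> = (\<Sum>k | k dvd n. if k dvd j then of_int (int k * b k) else 0)"
      by (intro sum.cong) auto
    also have "\<dots> = of_int (\<Sum>k | k dvd n \<and> k dvd j. int k * b k)"
      using n by (simp add: sum.If_cases Int_def)
    finally show ?thesis .
  qed
  thus ?thesis by (auto simp only: of_int_eq_iff)
qed

section \<open>Moebius inversion\<close>

lemma moebius_mu_prime_mult:
  assumes "prime p" "\<not> p dvd d" "squarefree d"
  shows "moebius_mu (p * d) = - moebius_mu d"
proof -
  have "d > 0" using assms(3) not_squarefree_0 by (metis gr0I)
  have "coprime p d" using assms by (simp add: prime_imp_coprime)
  hence "squarefree (p * d)" using assms by (simp add: squarefree_mult_coprime squarefree_prime)
  moreover have "prime_factors (p * d) = insert p (prime_factors d)"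
    using assms \<open>d > 0\<close> by (simp add: prime_factors_product prime_prime_factors prime_gt_0_nat)
  moreover have "p \<notin> prime_factors d" using assms by auto
  ultimately show ?thesis using assms by (simp add: moebius_mu_def)
qed

text \<open>
  For a prime \<open>p\<close> dividing \<open>n\<close>, the squarefree divisors of \<open>n\<close> fall into pairs \<open>d\<close>, \<open>p * d\<close> with \<open>p\<close> not dividing
  \<open>d\<close>, and the two members of a pair have opposite signs.
\<close>

lemma sum_moebius_mu:
  assumes "n > 0"
  shows "(\<Sum>d | d dvd n. moebius_mu d) = (if n = 1 then 1 else 0)"
proof (cases "n = 1")
  case True
  thus ?thesis by (simp add: moebius_mu_def)
next
  case False
  then obtain p where p: "prime p" "p dvd n" using prime_factor_nat by blast
  define T where "T = {d. d dvd n \<and> squarefree d \<and> \<not> p dvd d}"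
  have fin: "finite {d. d dvd n}" using assms by simp
  hence finT: "finite T" by (rule finite_subset[rotated]) (auto simp: T_def)
  have split: "{d. d dvd n \<and> squarefree d} = T \<union> (\<lambda>d. p * d) ` T"
  proof (intro equalityI subsetI)
    fix d assume "d \<in> {d. d dvd n \<and> squarefree d}"
    hence d: "d dvd n" "squarefree d" by auto
    show "d \<in> T \<union> (\<lambda>d. p * d) ` T"
    proof (cases "p dvd d")
      case True
      then obtain e where e: "d = p * e" by blast
      have "\<not> p dvd e"
      proof
        assume "p dvd e"
        hence "p ^ 2 dvd d" unfolding e by (simp add: power2_eq_square)
        hence "p dvd 1" using d(2) by (rule squarefreeD[rotated])
        thus False using p(1) by (simp add: not_prime_unit)
      qed
      moreover have "squarefree e" "e dvd n"
        using d squarefree_mono[of e "p * e"] unfolding e by (auto intro: dvd_trans[of e "p * e"])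
      ultimately show ?thesis unfolding e T_def by blast
    next
      case False
      thus ?thesis using d by (simp add: T_def)
    qed
  next
    fix d assume "d \<in> T \<union> (\<lambda>d. p * d) ` T"
    thus "d \<in> {d. d dvd n \<and> squarefree d}"
    proof
      assume "d \<in> T" thus ?thesis by (simp add: T_def)
    next
      assume "d \<in> (\<lambda>d. p * d) ` T"
      then obtain e where e: "d = p * e" "e dvd n" "squarefree e" "\<not> p dvd e" by (auto simp: T_def)
      have "coprime p e" using p e by (simp add: prime_imp_coprime)
      thus ?thesis using e p by (simp add: divides_mult squarefree_mult_coprime squarefree_prime)
    qed
  qed
  have "(\<Sum>d | d dvd n. moebius_mu d) = (\<Sum>d | d dvd n \<and> squarefree d. moebius_mu d)"
    using fin by (intro sum.mono_neutral_right) (auto simp: moebius_mu_def)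
  also have "\<dots> = (\<Sum>d\<in>T. moebius_mu d) + (\<Sum>d\<in>(\<lambda>d. p * d) ` T. moebius_mu d)"
    unfolding split using finT by (intro sum.union_disjoint) (auto simp: T_def)
  also have "(\<Sum>d\<in>(\<lambda>d. p * d) ` T. moebius_mu d) = (\<Sum>d\<in>T. - moebius_mu d)"
    using p(1) by (subst sum.reindex) (auto simp: inj_on_def T_def moebius_mu_prime_mult)
  finally show ?thesis using False by (simp add: sum_negf)
qed

text \<open>
  Exchanging the two summations leaves, for each \<open>d\<close>, the sum of the Moebius function over the
  divisors of \<open>k/d\<close>, which vanishes unless \<open>d = k\<close>. The hypothesis is confined to the divisors of
  one number because the values of \<open>f\<close> are divisor sums of cycle contributions at the
  divisors of \<open>n\<close>, but in general not elsewhere.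
\<close>

lemma moebius_inversion:
  fixes E G :: "nat \<Rightarrow> 'a :: comm_ring_1"
  assumes "k > 0" and G: "\<And>j. j dvd k \<Longrightarrow> G j = (\<Sum>d | d dvd j. E d)"
  shows "(\<Sum>j | j dvd k. of_int (moebius_mu (k div j)) * G j) = E k"
proof -
  have fin: "finite {j. j dvd k}" using assms by simp
  have "(\<Sum>j | j dvd k. of_int (moebius_mu (k div j)) * G j) =
      (\<Sum>j | j dvd k. \<Sum>d | d dvd k \<and> d dvd j. of_int (moebius_mu (k div j)) * E d)"
  proof (rule sum.cong[OF refl])
    fix j assume "j \<in> {j. j dvd k}"
    hence "j dvd k" by simp
    hence "{d. d dvd k \<and> d dvd j} = {d. d dvd j}" by (auto intro: dvd_trans)
    thus "of_int (moebius_mu (k div j)) * G j =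
        (\<Sum>d | d dvd k \<and> d dvd j. of_int (moebius_mu (k div j)) * E d)"
      using G[OF \<open>j dvd k\<close>] by (simp add: sum_distrib_left)
  qed
  also have "\<dots> = (\<Sum>d | d dvd k. \<Sum>j | j dvd k \<and> d dvd j. of_int (moebius_mu (k div j)) * E d)"
    using sum.swap_restrict[OF fin fin, of "\<lambda>j d. of_int (moebius_mu (k div j)) * E d" "\<lambda>j d. d dvd j"]
    by simp
  also have "\<dots> = (\<Sum>d | d dvd k. if d = k then E d else 0)"
  proof (rule sum.cong[OF refl])
    fix d assume "d \<in> {d. d dvd k}"
    then obtain m where m: "k = d * m" by auto
    hence dm: "d > 0" "m > 0" using assms by auto
    \<comment> \<open>The numbers \<open>j\<close> between \<open>d\<close> and \<open>k\<close> in divisibility are parametrised by \<open>c = k/j\<close>.\<close>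
    have "(\<Sum>j | j dvd k \<and> d dvd j. moebius_mu (k div j)) = (\<Sum>c | c dvd m. moebius_mu c)"
      using dm unfolding m
      by (intro sum.reindex_bij_witness[of _ "\<lambda>c. d * (m div c)" "\<lambda>j. d * m div j"])
        (auto elim!: dvdE)
    also have "\<dots> = (if d = k then 1 else 0)" using sum_moebius_mu[of m] dm by (simp add: m)
    finally have mu: "(\<Sum>j | j dvd k \<and> d dvd j. moebius_mu (k div j)) = (if d = k then 1 else 0)" .
    have "(\<Sum>j | j dvd k \<and> d dvd j. of_int (moebius_mu (k div j)) * E d) =
        of_int (\<Sum>j | j dvd k \<and> d dvd j. moebius_mu (k div j)) * E d"
      by (simp add: sum_distrib_right)
    thus "(\<Sum>j | j dvd k \<and> d dvd j. of_int (moebius_mu (k div j)) * E d) = (if d = k then E d else 0)"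
      unfolding mu by simp
  qed
  also have "\<dots> = E k" using fin assms by simp
  finally show ?thesis .
qed

section \<open>Fixed points of a cyclic action\<close>

text \<open>
  The times at which a point returns to itself are closed under addition and subtraction, so
  they are the multiples of the least positive one.
\<close>

lemma period_exists:
  fixes P :: "nat \<Rightarrow> bool"
  assumes "P n" "n > 0" and add: "\<And>a b. P a \<Longrightarrow> P (b + a) \<longleftrightarrow> P b"
  shows "\<exists>d. \<forall>t. P t \<longleftrightarrow> d dvd t"
proof -
  define d where "d = (LEAST d. P d \<and> d > 0)"
  have d: "P d \<and> d > 0"
    unfolding d_def by (rule LeastI[of "\<lambda>d. P d \<and> d > 0" n]) (simp add: assms)
  have least: "\<not> P t" if "0 < t" "t < d" for t
    using that not_less_Least[of t "\<lambda>d. P d \<and> d > 0"] by (auto simp: d_def)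
  have mult: "P (r + d * q) \<longleftrightarrow> P r" for q r
  proof (induction q)
    case (Suc q)
    have "P (r + d * Suc q) \<longleftrightarrow> P (r + d * q)"
      using add[of d "r + d * q"] d by (simp add: algebra_simps)
    thus ?case using Suc by simp
  qed simp
  have "P 0" using add[of d 0] d by simp
  have "P t \<longleftrightarrow> d dvd t" for t
  proof -
    have "P t \<longleftrightarrow> P (t mod d)" using mult[of "t mod d" "t div d"] by simp
    also have "\<dots> \<longleftrightarrow> t mod d = 0" using least[of "t mod d"] d \<open>P 0\<close> by auto
    finally show ?thesis by (simp add: dvd_eq_mod_eq_0)
  qed
  thus ?thesis by blast
qed

text \<open>
  A point is fixed by the \<open>j\<close>-th power of \<open>\<sigma>\<close> exactly if its period divides \<open>j\<close>. So the fixed point counts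
  are divisor sums of the numbers of points with a given period, to which Moebius
  inversion applies.
\<close>

lemma moebius_sum_fixed_points:
  assumes "group_action C X \<phi>" "finite X" "\<sigma> \<in> carrier C"
    and order: "\<sigma> [^]\<^bsub>C\<^esub> int n = \<one>\<^bsub>C\<^esub>" "n > 0" and "k > 0"
  shows "(\<Sum>j | j dvd k. of_int (moebius_mu (k div j)) * of_nat (card (invariants X \<phi> (\<sigma> [^]\<^bsub>C\<^esub> int j)))) =
    (of_nat (card {x\<in>X. \<forall>t. \<phi> (\<sigma> [^]\<^bsub>C\<^esub> int t) x = x \<longleftrightarrow> k dvd t}) :: complex)"
proof (rule moebius_inversion[OF \<open>k > 0\<close>])
  interpret group_action C X \<phi> by fact
  interpret group C using group_hom by (rule group_hom.axioms(1))
  define Q where "Q d = {x\<in>X. \<forall>t. \<phi> (\<sigma> [^]\<^bsub>C\<^esub> int t) x = x \<longleftrightarrow> d dvd t}" for d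
  have period: "\<exists>d. \<forall>t. \<phi> (\<sigma> [^]\<^bsub>C\<^esub> int t) x = x \<longleftrightarrow> d dvd t" if x: "x \<in> X" for x
  proof (rule period_exists[OF _ order(2)])
    show "\<phi> (\<sigma> [^]\<^bsub>C\<^esub> int n) x = x" using x order by (metis id_eq_one restrict_apply)
  next
    fix a b assume "\<phi> (\<sigma> [^]\<^bsub>C\<^esub> int a) x = x"
    moreover have "\<phi> (\<sigma> [^]\<^bsub>C\<^esub> int (b + a)) x = \<phi> (\<sigma> [^]\<^bsub>C\<^esub> int b) (\<phi> (\<sigma> [^]\<^bsub>C\<^esub> int a) x)"
      using assms(3) x composition_rule[of x "\<sigma> [^]\<^bsub>C\<^esub> int b" "\<sigma> [^]\<^bsub>C\<^esub> int a"]
      by (simp only: of_nat_add int_pow_mult int_pow_closed)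
    ultimately show "\<phi> (\<sigma> [^]\<^bsub>C\<^esub> int (b + a)) x = x \<longleftrightarrow> \<phi> (\<sigma> [^]\<^bsub>C\<^esub> int b) x = x" by simp
  qed
  fix j assume "j dvd k"
  hence j: "j > 0" using \<open>k > 0\<close> by (simp add: dvd_pos_nat)
  have "invariants X \<phi> (\<sigma> [^]\<^bsub>C\<^esub> int j) = (\<Union>d\<in>{d. d dvd j}. Q d)"
    using period by (auto simp: invariants_def Q_def)
  moreover have "card (\<Union>d\<in>{d. d dvd j}. Q d) = (\<Sum>d | d dvd j. card (Q d))"
  proof (rule card_UN_disjoint)
    show "\<forall>d\<in>{d. d dvd j}. \<forall>d'\<in>{d. d dvd j}. d \<noteq> d' \<longrightarrow> Q d \<inter> Q d' = {}"
      by (auto simp: Q_def) (metis dvd_antisym dvd_refl)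
  qed (use j \<open>finite X\<close> in \<open>auto simp: Q_def\<close>)
  ultimately show "(of_nat (card (invariants X \<phi> (\<sigma> [^]\<^bsub>C\<^esub> int j))) :: complex) =
      (\<Sum>d | d dvd j. of_nat (card {x\<in>X. \<forall>t. \<phi> (\<sigma> [^]\<^bsub>C\<^esub> int t) x = x \<longleftrightarrow> d dvd t}))"
    by (simp add: Q_def)
qed

section \<open>Cyclic actions with prescribed cycle lengths\<close>

lemma cyclic_group_int_pow_eq:
  assumes "cyclic_group_of_order n C \<sigma>"
  shows "\<sigma> [^]\<^bsub>C\<^esub> (s::int) = \<sigma> [^]\<^bsub>C\<^esub> t \<longleftrightarrow> int n dvd t - s"
proof -
  interpret group C using assms by (simp add: cyclic_group_of_order_def)
  have "\<sigma> \<in> carrier C" "ord \<sigma> = n"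
    using assms generate_pow_card[of \<sigma>] by (simp_all add: cyclic_group_of_order_def Coset.order_def)
  thus ?thesis by (simp add: int_pow_eq)
qed

text \<open>
  To define an action of a cyclic group it suffices to let the integers act with period \<open>n\<close>: an
  element acts through any of its discrete logarithms to the base \<open>\<sigma>\<close>, and two of them differ
  by a multiple of \<open>n\<close>.
\<close>

lemma cyclic_group_action_from_flow:
  fixes S :: "int \<Rightarrow> 'x \<Rightarrow> 'x"
  assumes C: "cyclic_group_of_order n C \<sigma>"
    and S: "\<And>t x. x \<in> X \<Longrightarrow> S t x \<in> X" "\<And>x. x \<in> X \<Longrightarrow> S 0 x = x"
      "\<And>s t x. x \<in> X \<Longrightarrow> S (s + t) x = S s (S t x)" "\<And>x. x \<in> X \<Longrightarrow> S (int n) x = x"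
  shows "\<exists>\<phi>. group_action C X \<phi> \<and> (\<forall>t. \<forall>x\<in>X. \<phi> (\<sigma> [^]\<^bsub>C\<^esub> t) x = S t x)"
proof -
  interpret group C using C by (simp add: cyclic_group_of_order_def)
  have \<sigma>: "\<sigma> \<in> carrier C" using C by (simp add: cyclic_group_of_order_def)
  have period: "S (int n * m) x = x" if x: "x \<in> X" for m x
  proof (induction m rule: int_induct[where k = 0])
    case base
    thus ?case using x S(2) by simp
  next
    case (step1 i)
    have "S (int n * (i + 1)) x = S (int n * i) (S (int n) x)"
      using S(3)[OF x, of "int n * i" "int n"] by (simp add: algebra_simps)
    thus ?case using step1 S(4)[OF x] by simp
  next
    case (step2 i)
    have "S (int n * i) x = S (int n * (i - 1)) (S (int n) x)"
      using S(3)[OF x, of "int n * (i - 1)" "int n"] by (simp add: algebra_simps)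
    thus ?case using step2 S(4)[OF x] by simp
  qed
  have S_cong: "S s x = S t x" if "\<sigma> [^]\<^bsub>C\<^esub> s = \<sigma> [^]\<^bsub>C\<^esub> t" and x: "x \<in> X" for s t x
  proof -
    have "int n dvd t - s" using that(1) by (simp add: cyclic_group_int_pow_eq[OF C])
    then obtain m where "t - s = int n * m" by (rule dvdE)
    hence "t = s + int n * m" by simp
    hence "S t x = S s (S (int n * m) x)" using S(3)[OF x, of s "int n * m"] by simp
    thus ?thesis by (simp add: period x)
  qed
  define dlog where "dlog g = (SOME t::int. \<sigma> [^]\<^bsub>C\<^esub> t = g)" for g
  have dlog: "\<sigma> [^]\<^bsub>C\<^esub> dlog g = g" if "g \<in> carrier C" for g
  proof -
    have "g \<in> generate C {\<sigma>}" using C that by (simp add: cyclic_group_of_order_def)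
    hence "\<exists>t::int. \<sigma> [^]\<^bsub>C\<^esub> t = g" unfolding generate_pow[OF \<sigma>] by auto
    thus ?thesis unfolding dlog_def by (rule someI_ex)
  qed
  define \<phi> where "\<phi> g = restrict (S (dlog g)) X" for g
  have \<phi>: "\<phi> (\<sigma> [^]\<^bsub>C\<^esub> t) x = S t x" if "x \<in> X" for t x
    using that \<sigma> by (simp add: \<phi>_def S_cong[OF dlog])
  have Bij: "\<phi> g \<in> Bij X" for g
  proof -
    have "bij_betw (S (dlog g)) X X"
      by (rule bij_betw_byWitness[where f' = "S (- dlog g)"])
        (auto simp: S(1,2) simp flip: S(3))
    thus ?thesis by (simp add: Bij_def \<phi>_def)
  qed
  have "\<phi> \<in> hom C (BijGroup X)"
  proof (rule homI)
    show "\<phi> g \<in> carrier (BijGroup X)" for g using Bij by (simp add: BijGroup_def)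
  next
    fix g h assume gh: "g \<in> carrier C" "h \<in> carrier C"
    have "\<sigma> [^]\<^bsub>C\<^esub> dlog (g \<otimes>\<^bsub>C\<^esub> h) = \<sigma> [^]\<^bsub>C\<^esub> (dlog g + dlog h)"
      using gh \<sigma> by (simp add: dlog int_pow_mult)
    hence "S (dlog (g \<otimes>\<^bsub>C\<^esub> h)) x = S (dlog g) (S (dlog h) x)" if "x \<in> X" for x
      using that S_cong S(3) by metis
    hence "\<phi> (g \<otimes>\<^bsub>C\<^esub> h) = compose X (\<phi> g) (\<phi> h)"
      by (auto simp: \<phi>_def compose_def fun_eq_iff S(1))
    thus "\<phi> (g \<otimes>\<^bsub>C\<^esub> h) = \<phi> g \<otimes>\<^bsub>BijGroup X\<^esub> \<phi> h" using Bij by (simp add: BijGroup_def)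
  qed
  hence "group_action C X \<phi>"
    by (intro group_action.intro group_hom.intro group_hom_axioms.intro group_BijGroup is_group)
  thus ?thesis using \<phi> by blast
qed

text \<open>
  A disjoint union of cycles: \<open>(k, m, r)\<close> is the position \<open>r\<close> on the \<open>m\<close>-th cycle of length \<open>k\<close>.
\<close>

definition cycles :: "nat \<Rightarrow> (nat \<Rightarrow> nat) \<Rightarrow> (nat \<times> nat \<times> nat) set" where
  "cycles n b = (SIGMA k:{k. k dvd n}. {..<b k} \<times> {..<k})"

definition rotate_cycles :: "int \<Rightarrow> nat \<times> nat \<times> nat \<Rightarrow> nat \<times> nat \<times> nat" where
  "rotate_cycles t = (\<lambda>(k, m, r). (k, m, nat ((int r + t) mod int k)))"

text \<open>
  Rotation by \<open>t\<close> fixes a cycle pointwise if its length divides \<open>t\<close> and moves all of its points otherwise.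
\<close>

lemma card_fixed_cycles:
  assumes "n > 0"
  shows "card {y \<in> cycles n b. rotate_cycles t y = y} = (\<Sum>k | k dvd n \<and> int k dvd t. k * b k)"
proof -
  have "nat ((int r + t) mod int k) = r \<longleftrightarrow> int k dvd t" if "r < k" for r k
  proof -
    have "nat ((int r + t) mod int k) = r \<longleftrightarrow> (int r + t) mod int k = int r mod int k"
      using that pos_mod_sign[of "int k" "int r + t"] by (auto simp: nat_eq_iff)
    also have "\<dots> \<longleftrightarrow> int k dvd t" by (simp add: mod_eq_dvd_iff)
    finally show ?thesis .
  qed
  hence "{y \<in> cycles n b. rotate_cycles t y = y} =
      (SIGMA k:{k. k dvd n \<and> int k dvd t}. {..<b k} \<times> {..<k})"
    by (auto simp: cycles_def rotate_cycles_def)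
  moreover have "finite {k. k dvd n \<and> int k dvd t}" using assms by simp
  ultimately show ?thesis by (simp add: mult.commute)
qed

text \<open>
  The rotations of the model \<open>cycles n b\<close> are transported to \<open>X\<close> along any bijection.
\<close>

lemma cyclic_action_with_cycle_counts:
  assumes C: "cyclic_group_of_order n C \<sigma>" and n: "n > 0"
    and X: "finite X" "card X = (\<Sum>k | k dvd n. k * b k)"
  shows "\<exists>\<phi>. group_action C X \<phi> \<and>
    (\<forall>t. card (invariants X \<phi> (\<sigma> [^]\<^bsub>C\<^esub> t)) = (\<Sum>k | k dvd n \<and> int k dvd t. k * b k))"
proof -
  let ?Y = "cycles n b" and ?R = rotate_cycles
  have R: "?R t y \<in> ?Y" "?R 0 y = y" "?R (s + t) y = ?R s (?R t y)" "?R (int n) y = y"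
    if "y \<in> ?Y" for s t y
  proof -
    obtain k m r where y: "y = (k, m, r)" "k dvd n" "m < b k" "r < k"
      using \<open>y \<in> ?Y\<close> by (auto simp: cycles_def)
    show "?R t y \<in> ?Y" using y by (auto simp: cycles_def rotate_cycles_def nat_less_iff)
    show "?R 0 y = y" using y by (simp add: rotate_cycles_def)
    have "((int r + t) mod int k + s) mod int k = (int r + t + s) mod int k"
      by (rule mod_add_left_eq)
    also have "int r + t + s = int r + (s + t)" by simp
    finally have "((int r + t) mod int k + s) mod int k = (int r + (s + t)) mod int k" .
    thus "?R (s + t) y = ?R s (?R t y)" using y by (simp add: rotate_cycles_def)
    have "(int r + int n) mod int k = int r"
      using y by (auto elim!: dvdE)
    thus "?R (int n) y = y" using y by (simp add: rotate_cycles_def)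
  qed
  have "finite ?Y" using n by (auto simp: cycles_def)
  moreover have "card X = card ?Y"
    using X card_fixed_cycles[OF n, of b 0] R(2) by (simp cong: conj_cong)
  ultimately obtain h where h: "bij_betw h X ?Y"
    using X finite_same_card_bij by metis
  define S where "S t x = inv_into X h (?R t (h x))" for t x
  have hX: "h x \<in> ?Y" if "x \<in> X" for x using h that by (auto simp: bij_betw_def)
  have S: "S t x \<in> X" "h (S t x) = ?R t (h x)" if "x \<in> X" for t x
    using h R(1)[OF hX[OF that]] that unfolding S_def bij_betw_def
    by (auto intro: inv_into_into f_inv_into_f)
  have eqI: "x = y" if "h x = h y" "x \<in> X" "y \<in> X" for x y
    using that h by (auto simp: bij_betw_def inj_on_def)
  have "\<exists>\<phi>. group_action C X \<phi> \<and> (\<forall>t. \<forall>x\<in>X. \<phi> (\<sigma> [^]\<^bsub>C\<^esub> t) x = S t x)"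
    by (rule cyclic_group_action_from_flow[OF C]) (auto intro!: eqI simp: S R hX)
  then obtain \<phi> where \<phi>: "group_action C X \<phi>" "\<And>t x. x \<in> X \<Longrightarrow> \<phi> (\<sigma> [^]\<^bsub>C\<^esub> t) x = S t x" by blast
  have "card (invariants X \<phi> (\<sigma> [^]\<^bsub>C\<^esub> t)) = (\<Sum>k | k dvd n \<and> int k dvd t. k * b k)" for t
  proof -
    have "h ` invariants X \<phi> (\<sigma> [^]\<^bsub>C\<^esub> t) = {y \<in> ?Y. ?R t y = y}"
    proof (intro equalityI subsetI)
      fix y assume "y \<in> h ` invariants X \<phi> (\<sigma> [^]\<^bsub>C\<^esub> t)"
      thus "y \<in> {y \<in> ?Y. ?R t y = y}" using \<phi>(2) S(2) hX by (auto simp: invariants_def) metis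
    next
      fix y assume y: "y \<in> {y \<in> ?Y. ?R t y = y}"
      then obtain x where x: "x \<in> X" "y = h x" using h by (auto simp: bij_betw_def)
      hence "S t x = x" using y S[of x t] by (intro eqI) auto
      thus "y \<in> h ` invariants X \<phi> (\<sigma> [^]\<^bsub>C\<^esub> t)" using x \<phi>(2) by (auto simp: invariants_def)
    qed
    moreover have "inj_on h (invariants X \<phi> (\<sigma> [^]\<^bsub>C\<^esub> t))"
      using eqI by (auto simp: invariants_def inj_on_def)
    ultimately show ?thesis using card_fixed_cycles[OF n, of b t] by (metis card_image)
  qed
  thus ?thesis using \<phi>(1) by blast
qed

section \<open>The criterion for cyclic sieving\<close>

theorem theorem2p7:
  fixes n :: nat and \<omega> :: complex and f :: "nat poly"
    and C :: "('g, 'm) monoid_scheme" and \<sigma> :: 'g and X :: "'x set"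
  assumes "n \<ge> 1"
    and "primitive_root_of_unity n \<omega>"
    and "cyclic_group_of_order n C \<sigma>"
    and "\<forall>j\<in>{1..n}. poly_value f (\<omega> ^ j) \<in> \<nat>"
    and "finite X" and "card X = poly f 1"
  shows "(\<exists>\<phi>. group_action C X \<phi> \<and> exhibits_csp n \<omega> C \<sigma> X \<phi> f) \<longleftrightarrow>
    (\<forall>k. k dvd n \<longrightarrow>
       0 \<le> (\<Sum>j | j dvd k. of_int (moebius_mu (k div j)) * poly_value f (\<omega> ^ j)))"
    (is "?csp \<longleftrightarrow> ?nonneg")
proof
  have n: "n > 0" using assms(1) by simp
  note prim = assms(2)
  note C = assms(3)
  interpret group C using C by (simp add: cyclic_group_of_order_def)
  have \<sigma>: "\<sigma> \<in> carrier C" using C by (simp add: cyclic_group_of_order_def)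
  {
    assume ?csp
    then obtain \<phi> where \<phi>: "group_action C X \<phi>" "exhibits_csp n \<omega> C \<sigma> X \<phi> f" by blast
    have val: "poly_value f (\<omega> ^ j) = of_nat (card (invariants X \<phi> (\<sigma> [^]\<^bsub>C\<^esub> int j)))" for j :: nat
      using \<phi>(2) unfolding exhibits_csp_def by (metis power_int_of_nat)
    have order: "\<sigma> [^]\<^bsub>C\<^esub> int n = \<one>\<^bsub>C\<^esub>"
      using cyclic_group_int_pow_eq[OF C, of "int n" 0] by simp
    show ?nonneg
    proof (intro allI impI)
      fix k assume "k dvd n"
      hence "k > 0" using n by (simp add: dvd_pos_nat)
      show "0 \<le> (\<Sum>j | j dvd k. of_int (moebius_mu (k div j)) * poly_value f (\<omega> ^ j))"
        unfolding val moebius_sum_fixed_points[OF \<phi>(1) \<open>finite X\<close> \<sigma> order n \<open>k > 0\<close>]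
          by (simp add: less_eq_complex_def)
    qed
  }
  assume nonneg: ?nonneg
  have "\<exists>m::nat. poly_value f (\<omega> ^ j) = of_nat m" for j
  proof (cases "n dvd j")
    case True
    \<comment> \<open>The exponents in the hypothesis run from \<open>1\<close> to \<open>n\<close>, so the residue \<open>0\<close> is represented by \<open>n\<close>.\<close>
    hence "\<omega> ^ j = \<omega> ^ n"
      using primitive_root_power_eq_1_iff[OF prim, of j] primitive_root_power_eq_1_iff[OF prim, of n] by simp
    thus ?thesis using assms(1,4) by (auto elim!: Nats_cases)
  next
    case False
    hence "j mod n \<in> {1..n}" using n by (simp add: Suc_le_eq mod_greater_zero_iff_not_dvd)
    hence "poly_value f (\<omega> ^ (j mod n)) \<in> \<nat>" using assms(4) by blast
    thus ?thesis unfolding primitive_root_power_mod[OF prim] by (auto elim!: Nats_cases)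
  qed
  then obtain g :: "nat \<Rightarrow> nat" where val: "\<And>j. poly_value f (\<omega> ^ j) = of_nat (g j)" by metis
  obtain b :: "nat \<Rightarrow> int" where b: "\<And>j. int (g j) = (\<Sum>k | k dvd n \<and> k dvd j. int k * b k)"
    using value_decomposition[OF prim val] by blast
  \<comment> \<open>By inversion, the sum in the hypothesis is \<open>k * b k\<close>.\<close>
  have b_nonneg: "b k \<ge> 0" if "k dvd n" for k
  proof -
    have k: "k > 0" using n that by (simp add: dvd_pos_nat)
    have "(\<Sum>j | j dvd k. of_int (moebius_mu (k div j)) * poly_value f (\<omega> ^ j)) =
        of_int (int k * b k)"
    proof (rule moebius_inversion[OF k])
      fix j assume "j dvd k"
      hence "{d. d dvd n \<and> d dvd j} = {d. d dvd j}" using that by (auto intro: dvd_trans)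
      hence "int (g j) = (\<Sum>d | d dvd j. int d * b d)" using b[of j] by simp
      hence "of_int (int (g j)) = (of_int (\<Sum>d | d dvd j. int d * b d) :: complex)" by (simp only:)
      thus "poly_value f (\<omega> ^ j) = (\<Sum>d | d dvd j. of_int (int d * b d))"
        by (simp add: val)
    qed
    hence "0 \<le> (of_int (int k * b k) :: complex)" using nonneg that by metis
    hence "0 \<le> real_of_int (int k * b k)" by (simp add: less_eq_complex_def)
    hence "0 \<le> int k * b k" by (simp only: of_int_0_le_iff)
    thus ?thesis using k by (simp add: zero_le_mult_iff)
  qed
  define B where "B k = nat (b k)" for k
  have g: "g j = (\<Sum>k | k dvd n \<and> k dvd j. k * B k)" for j
  proof -
    have "int (g j) = int (\<Sum>k | k dvd n \<and> k dvd j. k * B k)"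
      unfolding b of_nat_sum by (intro sum.cong) (auto simp: B_def b_nonneg)
    thus ?thesis by (simp only: of_nat_eq_iff)
  qed
  have "of_nat (poly f 1) = poly_value f (\<omega> ^ 0)"
    by (simp add: poly_value_altdef poly_altdef)
  hence "poly f 1 = g 0" unfolding val by (simp only: of_nat_eq_iff)
  hence "card X = (\<Sum>k | k dvd n. k * B k)" using assms(6) g[of 0] by simp
  then obtain \<phi> where \<phi>: "group_action C X \<phi>"
    "\<And>t. card (invariants X \<phi> (\<sigma> [^]\<^bsub>C\<^esub> t)) = (\<Sum>k | k dvd n \<and> int k dvd t. k * B k)"
    using cyclic_action_with_cycle_counts[OF C n \<open>finite X\<close>] by blast
  have "poly_value f (\<omega> powi t) = of_nat (card (invariants X \<phi> (\<sigma> [^]\<^bsub>C\<^esub> t)))" for t :: int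
  proof -
    define j where "j = nat (t mod int n)"
    have j: "int j = t mod int n" using n by (simp add: j_def)
    have "\<omega> \<noteq> 0" using prim n by (auto simp: primitive_root_of_unity_def zero_power)
    have "\<omega> powi t = \<omega> powi (int n * (t div int n) + int j)" by (simp add: j)
    also have "\<dots> = \<omega> ^ j"
      using \<open>\<omega> \<noteq> 0\<close> prim by (simp add: power_int_add power_int_mult primitive_root_of_unity_def)
    finally have "\<omega> powi t = \<omega> ^ j" .
    moreover have "int k dvd t \<longleftrightarrow> k dvd j" if "k dvd n" for k
    proof -
      have "int k dvd t \<longleftrightarrow> int k dvd t mod int n" using that by (simp add: dvd_mod_iff)
      thus ?thesis by (simp flip: j)
    qed
    hence "{k. k dvd n \<and> int k dvd t} = {k. k dvd n \<and> k dvd j}" by auto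
    ultimately show ?thesis by (simp add: \<phi>(2) val g)
  qed
  thus ?csp using \<phi>(1) prim C \<open>finite X\<close> unfolding exhibits_csp_def by blast
qed

end
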